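(* Let $A_1=\mathbb{Q}\langle s,t : st-ts=1\rangle$ denote the first Weyl algebra over the field $\mathbb{Q}$ of rational numbers and let $\ast$ denote the $\mathbb{Q}$-involution of $A_1$ such that $s^{\ast}=-s$ and $t^{\ast}=t$. Let $D_1$ be the division ring of fractions of $A_1$. Then $D_1$ contains a free (associative, unital) $\mathbb{Q}$-subalgebra of rank $2$ freely generated by two elements which are symmetric with respect to the extension of $\ast$ to $D_1$.
   Context: A $\mathbb{Q}$-involution on a $\mathbb{Q}$-algebra $D$ is a $\mathbb{Q}$-linear map $\ast\colon D\to D$ with $(ab)^{\ast}=b^{\ast}a^{\ast}$ and $a^{\ast\ast}=a$ for all $a,b\in D$. An element $a$ is symmetric if $a^{\ast}=a$. The algebra $A_1$ is an Ore domain, and the involution $\ast$ of $A_1$ extends uniquely to a $\mathbb{Q}$-involution of its division ring of fractions $D_1$, again denoted $\ast$. *)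

theory Defs
  imports
    "HOL-Library.Poly_Mapping"
    "HOL-Computational_Algebra.Polynomial"
begin

section \<open>Algebras over the rationals\<close>

class rat_algebra_1 = ring_1 +
  fixes scaleQ :: "rat \<Rightarrow> 'a \<Rightarrow> 'a"  (infixr \<open>*\<^sub>Q\<close> 75)
  assumes scaleQ_add_right: "q *\<^sub>Q (a + b) = q *\<^sub>Q a + q *\<^sub>Q b"
    and scaleQ_add_left: "(p + q) *\<^sub>Q a = p *\<^sub>Q a + q *\<^sub>Q a"
    and scaleQ_scaleQ: "p *\<^sub>Q (q *\<^sub>Q a) = (p * q) *\<^sub>Q a"
    and scaleQ_one: "1 *\<^sub>Q a = a"
    and mult_scaleQ_left: "(q *\<^sub>Q a) * b = q *\<^sub>Q (a * b)"
    and mult_scaleQ_right: "a * (q *\<^sub>Q b) = q *\<^sub>Q (a * b)"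

lemma module_scaleQ: "module (scaleQ :: rat \<Rightarrow> 'a \<Rightarrow> 'a::rat_algebra_1)"
  by unfold_locales (simp_all add: scaleQ_add_right scaleQ_add_left scaleQ_scaleQ scaleQ_one)

lemma scaleQ_eq_mult: "q *\<^sub>Q (a::'a::rat_algebra_1) = (q *\<^sub>Q 1) * a"
  by (simp add: mult_scaleQ_left)

instantiation rat :: rat_algebra_1
begin
definition scaleQ_rat :: "rat \<Rightarrow> rat \<Rightarrow> rat" where "scaleQ_rat = (*)"
instance by standard (simp_all add: scaleQ_rat_def algebra_simps)
end

definition rat_algebra_hom :: "('a::rat_algebra_1 \<Rightarrow> 'b::rat_algebra_1) \<Rightarrow> bool" where
  "rat_algebra_hom h \<longleftrightarrow>
     (\<forall>a b. h (a + b) = h a + h b) \<and> (\<forall>q a. h (q *\<^sub>Q a) = q *\<^sub>Q h a) \<and>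
     (\<forall>a b. h (a * b) = h a * h b) \<and> h 1 = 1"

definition rat_involution :: "('a::rat_algebra_1 \<Rightarrow> 'a) \<Rightarrow> bool" where
  "rat_involution \<sigma> \<longleftrightarrow>
     (\<forall>a b. \<sigma> (a + b) = \<sigma> a + \<sigma> b) \<and> (\<forall>q a. \<sigma> (q *\<^sub>Q a) = q *\<^sub>Q \<sigma> a) \<and>
     (\<forall>a b. \<sigma> (a * b) = \<sigma> b * \<sigma> a) \<and> (\<forall>a. \<sigma> (\<sigma> a) = a)"

definition rat_subalgebra :: "'a::rat_algebra_1 set \<Rightarrow> bool" where
  "rat_subalgebra B \<longleftrightarrow>
     1 \<in> B \<and> (\<forall>a\<in>B. \<forall>b\<in>B. a + b \<in> B) \<and> (\<forall>q. \<forall>a\<in>B. q *\<^sub>Q a \<in> B) \<and>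
     (\<forall>a\<in>B. \<forall>b\<in>B. a * b \<in> B)"

definition generated_rat_subalgebra :: "'a::rat_algebra_1 set \<Rightarrow> 'a set" where
  "generated_rat_subalgebra S = \<Inter>{B. rat_subalgebra B \<and> S \<subseteq> B}"

definition two_sided_ideal :: "'a::ring_1 set \<Rightarrow> bool" where
  "two_sided_ideal I \<longleftrightarrow>
     0 \<in> I \<and> (\<forall>a\<in>I. \<forall>b\<in>I. a + b \<in> I) \<and> (\<forall>r. \<forall>a\<in>I. r * a \<in> I \<and> a * r \<in> I)"

definition generated_ideal :: "'a::ring_1 set \<Rightarrow> 'a set" where
  "generated_ideal S = \<Inter>{I. two_sided_ideal I \<and> S \<subseteq> I}"

lemma two_sided_ideal_generated: "two_sided_ideal (generated_ideal S)"
  unfolding two_sided_ideal_def generated_ideal_def by blast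

lemma generated_ideal_superset: "S \<subseteq> generated_ideal S"
  unfolding generated_ideal_def by blast

lemma generated_ideal_least: "two_sided_ideal I \<Longrightarrow> S \<subseteq> I \<Longrightarrow> generated_ideal S \<subseteq> I"
  unfolding generated_ideal_def by blast

text \<open>
  A division ring together with an embedding \<open>\<iota>\<close> of \<open>A\<close> such that every element is a fraction
  \<open>a b\<^sup>-\<^sup>1\<close>. For an Ore domain \<open>A\<close> this determines the pair up to a unique isomorphism over \<open>A\<close>.
\<close>

definition division_ring_of_fractions ::
    "('a::rat_algebra_1 \<Rightarrow> 'd::{division_ring, rat_algebra_1}) \<Rightarrow> bool" where
  "division_ring_of_fractions \<iota> \<longleftrightarrow>
     rat_algebra_hom \<iota> \<and> inj \<iota> \<and> (\<forall>d. \<exists>a b. b \<noteq> 0 \<and> d = \<iota> a * inverse (\<iota> b))"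


section \<open>Free algebras\<close>

text \<open>
  The library's convolution product on finitely supported functions is indexed by an additively
  written, not necessarily commutative, monoid. Hence concatenation of words is written \<open>+\<close>.
\<close>

datatype 'x free_monoid = Monomial (letters: "'x list")

instantiation free_monoid :: (type) monoid_add
begin
definition zero_free_monoid :: "'a free_monoid" where "0 = Monomial []"
definition plus_free_monoid :: "'a free_monoid \<Rightarrow> 'a free_monoid \<Rightarrow> 'a free_monoid" where
  "v + w = Monomial (letters v @ letters w)"
instance by standard (simp_all add: zero_free_monoid_def plus_free_monoid_def)
end

lemma letters_zero [simp]: "letters 0 = []"
  by (simp add: zero_free_monoid_def)

lemma letters_plus [simp]: "letters (v + w) = letters v @ letters w"
  by (simp add: plus_free_monoid_def)

lemma poly_mapping_single_induct [case_names single add]: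
  fixes p :: "'k \<Rightarrow>\<^sub>0 'a::comm_monoid_add"
  assumes single: "\<And>k c. P (Poly_Mapping.single k c)"
    and add: "\<And>p q. P p \<Longrightarrow> P q \<Longrightarrow> P (p + q)"
  shows "P p"
proof (induction p rule: update_induct)
  case const
  show ?case using single[of _ 0] by simp
next
  case (update p k c)
  have "Poly_Mapping.update k c p = p + Poly_Mapping.single k c"
    using update.hyps
    by (intro poly_mapping_eqI)
      (auto simp: lookup_update lookup_add lookup_single when_def in_keys_iff)
  then show ?case using add[OF update.IH single] by simp
qed

instantiation poly_mapping :: (monoid_add, rat_algebra_1) rat_algebra_1
begin
definition scaleQ_poly_mapping :: "rat \<Rightarrow> ('a \<Rightarrow>\<^sub>0 'b) \<Rightarrow> ('a \<Rightarrow>\<^sub>0 'b)" where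
  "q *\<^sub>Q p = Poly_Mapping.single 0 (q *\<^sub>Q 1) * p"
instance
proof
  fix p q :: rat and a b :: "'a \<Rightarrow>\<^sub>0 'b"
  show "q *\<^sub>Q (a + b) = q *\<^sub>Q a + q *\<^sub>Q b"
    by (simp add: scaleQ_poly_mapping_def algebra_simps)
  show "(p + q) *\<^sub>Q a = p *\<^sub>Q a + q *\<^sub>Q a"
    by (simp add: scaleQ_poly_mapping_def scaleQ_add_left single_add algebra_simps)
  show "p *\<^sub>Q (q *\<^sub>Q a) = (p * q) *\<^sub>Q a"
    by (simp add: scaleQ_poly_mapping_def mult_single mult_scaleQ_left scaleQ_scaleQ
        flip: mult.assoc)
  show "1 *\<^sub>Q a = a"
    by (simp add: scaleQ_poly_mapping_def scaleQ_one)
  show "(q *\<^sub>Q a) * b = q *\<^sub>Q (a * b)"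
    by (simp add: scaleQ_poly_mapping_def mult.assoc)
  have "a * Poly_Mapping.single 0 (q *\<^sub>Q 1) = Poly_Mapping.single 0 (q *\<^sub>Q 1) * a"
    by (induction a rule: poly_mapping_single_induct)
      (simp_all add: mult_single mult_scaleQ_left mult_scaleQ_right algebra_simps)
  then show "a * (q *\<^sub>Q b) = q *\<^sub>Q (a * b)"
    by (simp add: scaleQ_poly_mapping_def flip: mult.assoc)
qed
end

lemma lookup_scaleQ: "Poly_Mapping.lookup (q *\<^sub>Q p) k = q *\<^sub>Q Poly_Mapping.lookup p k"
  by (induction p rule: poly_mapping_single_induct)
    (auto simp: scaleQ_poly_mapping_def mult_single lookup_single lookup_add mult_scaleQ_left
      scaleQ_add_right when_def algebra_simps
      module.scale_zero_right[OF module_scaleQ])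

type_synonym 'x free_algebra = "'x free_monoid \<Rightarrow>\<^sub>0 rat"

definition free_var :: "'x \<Rightarrow> 'x free_algebra" where
  "free_var x = Poly_Mapping.single (Monomial [x]) 1"

definition free_eval :: "('x \<Rightarrow> 'a::rat_algebra_1) \<Rightarrow> 'x free_algebra \<Rightarrow> 'a" where
  "free_eval f p =
     (\<Sum>w\<in>Poly_Mapping.keys p. Poly_Mapping.lookup p w *\<^sub>Q prod_list (map f (letters w)))"

context module
begin

lemma sum_keys_add:
  "(\<Sum>w\<in>Poly_Mapping.keys (p + q). Poly_Mapping.lookup (p + q) w *s g w) =
   (\<Sum>w\<in>Poly_Mapping.keys p. Poly_Mapping.lookup p w *s g w) +
   (\<Sum>w\<in>Poly_Mapping.keys q. Poly_Mapping.lookup q w *s g w)"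
proof -
  let ?K = "Poly_Mapping.keys p \<union> Poly_Mapping.keys q"
  have *: "(\<Sum>w\<in>Poly_Mapping.keys r. Poly_Mapping.lookup r w *s g w) =
    (\<Sum>w\<in>?K. Poly_Mapping.lookup r w *s g w)"
    if "Poly_Mapping.keys r \<subseteq> ?K" for r
    using that by (intro sum.mono_neutral_left) (auto simp: in_keys_iff)
  show ?thesis
    using *[of p] *[of q] *[of "p + q"] keys_add[of p q]
    by (simp add: lookup_add scale_left_distrib sum.distrib)
qed

lemma sum_keys_single:
  "(\<Sum>w\<in>Poly_Mapping.keys (Poly_Mapping.single k c).
     Poly_Mapping.lookup (Poly_Mapping.single k c) w *s g w) = c *s g k"
  by (cases "c = 0") simp_all

end

lemma free_eval_add: "free_eval f (p + q) = free_eval f p + free_eval f q"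
  unfolding free_eval_def by (rule module.sum_keys_add[OF module_scaleQ])

lemma free_eval_single:
  "free_eval f (Poly_Mapping.single w c) = c *\<^sub>Q prod_list (map f (letters w))"
  unfolding free_eval_def by (rule module.sum_keys_single[OF module_scaleQ])

lemma free_eval_mult: "free_eval f (p * q) = free_eval f p * free_eval f q"
proof (induction p rule: poly_mapping_single_induct)
  case (single v c)
  show ?case
    by (induction q rule: poly_mapping_single_induct)
      (simp_all add: mult_single free_eval_single free_eval_add mult_scaleQ_left mult_scaleQ_right
        scaleQ_scaleQ algebra_simps)
qed (simp add: free_eval_add algebra_simps)

lemma free_eval_hom: "rat_algebra_hom (free_eval f)"
proof -
  have "free_eval f 1 = 1"
    using free_eval_single[of f 0 1] by (simp add: scaleQ_one)
  moreover have "free_eval f (q *\<^sub>Q p) = q *\<^sub>Q free_eval f p" for q p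
    by (simp add: scaleQ_poly_mapping_def scaleQ_rat_def free_eval_mult free_eval_single
        mult_scaleQ_left)
  ultimately show ?thesis
    by (simp add: rat_algebra_hom_def free_eval_add free_eval_mult)
qed

lemma free_eval_var [simp]: "free_eval f (free_var x) = f x"
  by (simp add: free_var_def free_eval_single scaleQ_one)

definition freely_generated_by :: "'a::rat_algebra_1 set \<Rightarrow> ('x \<Rightarrow> 'a) \<Rightarrow> bool" where
  "freely_generated_by B f \<longleftrightarrow>
     B = generated_rat_subalgebra (f ` UNIV) \<and> inj (free_eval f)"


section \<open>The first Weyl algebra\<close>

datatype weyl_gen = Gen_s | Gen_t

definition weyl_ideal :: "weyl_gen free_algebra set" where
  "weyl_ideal = generated_ideal
     {free_var Gen_s * free_var Gen_t - free_var Gen_t * free_var Gen_s - 1}"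

lemma weyl_ideal: "two_sided_ideal weyl_ideal"
  unfolding weyl_ideal_def by (rule two_sided_ideal_generated)

lemma weyl_ideal_add: "p \<in> weyl_ideal \<Longrightarrow> q \<in> weyl_ideal \<Longrightarrow> p + q \<in> weyl_ideal"
  and weyl_ideal_left: "p \<in> weyl_ideal \<Longrightarrow> r * p \<in> weyl_ideal"
  and weyl_ideal_right: "p \<in> weyl_ideal \<Longrightarrow> p * r \<in> weyl_ideal"
  and weyl_ideal_zero: "0 \<in> weyl_ideal"
  using weyl_ideal unfolding two_sided_ideal_def by blast+

lemma weyl_ideal_uminus: "p \<in> weyl_ideal \<Longrightarrow> - p \<in> weyl_ideal"
  using weyl_ideal_left[of p "- 1"] by simp

text \<open>
  The ideal is proper because the free algebra acts on rational polynomials in one variable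
  with \<open>s\<close> acting as the derivative and \<open>t\<close> as multiplication by the variable.
\<close>

fun gen_act :: "weyl_gen \<Rightarrow> rat poly \<Rightarrow> rat poly" where
  "gen_act Gen_s f = pderiv f"
| "gen_act Gen_t f = pCons 0 f"

definition weyl_act :: "weyl_gen free_algebra \<Rightarrow> rat poly \<Rightarrow> rat poly" where
  "weyl_act p f =
     (\<Sum>w\<in>Poly_Mapping.keys p. smult (Poly_Mapping.lookup p w) (foldr gen_act (letters w) f))"

lemma module_smult: "module (smult :: rat \<Rightarrow> rat poly \<Rightarrow> rat poly)"
  by unfold_locales (simp_all add: smult_add_right smult_add_left)

lemma weyl_act_add: "weyl_act (p + q) f = weyl_act p f + weyl_act q f"
  unfolding weyl_act_def by (rule module.sum_keys_add[OF module_smult])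

lemma weyl_act_single:
  "weyl_act (Poly_Mapping.single w c) f = smult c (foldr gen_act (letters w) f)"
  unfolding weyl_act_def by (rule module.sum_keys_single[OF module_smult])

lemma gen_act_linear:
  "gen_act g (f + h) = gen_act g f + gen_act g h" "gen_act g (smult c f) = smult c (gen_act g f)"
  by (cases g; simp add: pderiv_add pderiv_smult)+

lemma foldr_gen_act_linear:
  "foldr gen_act w (f + h) = foldr gen_act w f + foldr gen_act w h"
  "foldr gen_act w (smult c f) = smult c (foldr gen_act w f)"
  by (induction w) (simp_all add: gen_act_linear)

lemma weyl_act_mult: "weyl_act (p * q) f = weyl_act p (weyl_act q f)"
proof (induction p rule: poly_mapping_single_induct)
  case (single v c)
  show ?case
    by (induction q rule: poly_mapping_single_induct)
      (simp_all add: mult_single weyl_act_single weyl_act_add foldr_gen_act_linear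
        smult_add_right algebra_simps)
qed (simp add: weyl_act_add algebra_simps)

lemma one_notin_weyl_ideal: "1 \<notin> weyl_ideal"
proof
  assume "1 \<in> weyl_ideal"
  define J where "J = {p. \<forall>f. weyl_act p f = 0}"
  have zero: "weyl_act p 0 = 0" for p
    using weyl_act_mult[of p 0 0] by (simp add: weyl_act_def)
  have one: "weyl_act 1 f = f" for f
    using weyl_act_single[of 0 1 f] by simp
  have diff: "weyl_act (p - q) f = weyl_act p f - weyl_act q f" for p q f
    using weyl_act_add[of "p - q" q f] by simp
  have "two_sided_ideal J"
    unfolding two_sided_ideal_def J_def
    by (auto simp: weyl_act_add weyl_act_mult zero) (simp add: weyl_act_def)
  moreover have "free_var Gen_s * free_var Gen_t - free_var Gen_t * free_var Gen_s - 1 \<in> J"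
    by (simp add: J_def diff weyl_act_mult one free_var_def weyl_act_single pderiv_pCons)
  ultimately have "weyl_ideal \<subseteq> J"
    unfolding weyl_ideal_def by (intro generated_ideal_least) auto
  with \<open>1 \<in> weyl_ideal\<close> have "weyl_act 1 1 = 0"
    by (auto simp: J_def)
  then show False by (simp add: one)
qed

quotient_type weyl = "weyl_gen free_algebra" / "\<lambda>p q. p - q \<in> weyl_ideal"
proof (rule equivpI)
  show "reflp (\<lambda>p q. p - q \<in> weyl_ideal)"
    by (simp add: reflp_def weyl_ideal_zero)
  show "symp (\<lambda>p q. p - q \<in> weyl_ideal)"
    by (rule sympI) (metis weyl_ideal_uminus minus_diff_eq)
  show "transp (\<lambda>p q. p - q \<in> weyl_ideal)"
    by (rule transpI) (metis weyl_ideal_add diff_add_cancel add_diff_eq)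
qed

instantiation weyl :: rat_algebra_1
begin

lift_definition zero_weyl :: weyl is 0 .
lift_definition one_weyl :: weyl is 1 .

lift_definition plus_weyl :: "weyl \<Rightarrow> weyl \<Rightarrow> weyl" is "(+)"
  by (metis weyl_ideal_add add_diff_add)

lift_definition uminus_weyl :: "weyl \<Rightarrow> weyl" is uminus
  by (metis weyl_ideal_uminus minus_diff_minus)

lift_definition minus_weyl :: "weyl \<Rightarrow> weyl \<Rightarrow> weyl" is "(-)"
proof -
  fix p p' q q' :: "weyl_gen free_algebra"
  assume "p - p' \<in> weyl_ideal" "q - q' \<in> weyl_ideal"
  then have "(p - p') + - (q - q') \<in> weyl_ideal"
    by (intro weyl_ideal_add weyl_ideal_uminus)
  then show "p - q - (p' - q') \<in> weyl_ideal" by (simp add: algebra_simps)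
qed

lift_definition times_weyl :: "weyl \<Rightarrow> weyl \<Rightarrow> weyl" is "(*)"
proof -
  fix p p' q q' :: "weyl_gen free_algebra"
  assume "p - p' \<in> weyl_ideal" "q - q' \<in> weyl_ideal"
  then have "(p - p') * q + p' * (q - q') \<in> weyl_ideal"
    by (intro weyl_ideal_add weyl_ideal_left weyl_ideal_right)
  then show "p * q - p' * q' \<in> weyl_ideal" by (simp add: algebra_simps)
qed

lift_definition scaleQ_weyl :: "rat \<Rightarrow> weyl \<Rightarrow> weyl" is "(*\<^sub>Q)"
  by (metis scaleQ_poly_mapping_def right_diff_distrib weyl_ideal_left)

instance
proof
  fix a b c :: weyl and p q :: rat
  show "(0::weyl) \<noteq> 1"
    by transfer (use weyl_ideal_uminus[of "- 1"] one_notin_weyl_ideal in auto)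
qed (transfer; simp add: algebra_simps weyl_ideal_zero scaleQ_add_right scaleQ_add_left
    scaleQ_scaleQ scaleQ_one mult_scaleQ_left mult_scaleQ_right)+

end

lift_definition weyl_s :: weyl is "free_var Gen_s" .
lift_definition weyl_t :: weyl is "free_var Gen_t" .

lemma weyl_relation: "weyl_s * weyl_t - weyl_t * weyl_s = 1"
  by transfer (use generated_ideal_superset in \<open>auto simp: weyl_ideal_def\<close>)

end

theory Submission
  imports
    Defs
    "HOL-Computational_Algebra.Formal_Laurent_Series"
    "HOL-Computational_Algebra.Polynomial_FPS"
begin

text \<open>
  Let \<open>K = \<rat>(t)\<close>, on which commutation with \<open>s\<close> is the derivative, and consider the operators
  \<open>Y\<^sub>i = s\<^sup>-\<^sup>1 g\<^sub>i\<close> with \<open>g\<^sub>i \<in> K\<close>, whose words are iterated integrals. If the \<open>g\<^sub>i\<close> are linearly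
  independent over the constants modulo derivatives, then the words in the \<open>Y\<^sub>i\<close> are left linearly
  independent over \<open>K\<close>: in a shortest relation make one coefficient of a longest word equal to \<open>1\<close>
  and multiply by \<open>s\<close> from the left. This differentiates the coefficients of the longest words, so
  these are constants, and comparing coefficients at the words one letter shorter expresses a
  nontrivial constant combination of the \<open>g\<^sub>i\<close> as a derivative.

  With \<open>G = 1 + 1/t\<close>, \<open>g\<^sub>1 = G\<^sup>2\<close> and \<open>g\<^sub>2 = 1/(t - 1)\<close> the elements
  \<open>x\<^sub>i = G s\<^sup>-\<^sup>1 g\<^sub>i s\<^sup>-\<^sup>1 G\<close> are symmetric, and a word \<open>x\<^sub>i x\<^sub>j \<dots>\<close> times \<open>G\<close> is
  \<open>G Y\<^sub>i Y\<^sub>1 Y\<^sub>j Y\<^sub>1 \<dots>\<close>, from which \<open>i, j, \<dots>\<close> can be read off.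
\<close>

section \<open>Independence of iterated integrals\<close>

text \<open>
  The coefficient of the empty word may lie in a larger set \<open>R\<close>, because multiplication by \<open>s\<close>
  turns it into a differential operator.
\<close>

locale ore_words =
  fixes s :: "'d::division_ring" and K R :: "'d set" and g :: "'i::finite \<Rightarrow> 'd"
  assumes K_add: "\<And>a b. a \<in> K \<Longrightarrow> b \<in> K \<Longrightarrow> a + b \<in> K"
    and K_mult: "\<And>a b. a \<in> K \<Longrightarrow> b \<in> K \<Longrightarrow> a * b \<in> K"
    and K_inverse: "\<And>a. a \<in> K \<Longrightarrow> inverse a \<in> K"
    and K_zero: "0 \<in> K"
    and K_uminus: "\<And>a. a \<in> K \<Longrightarrow> - a \<in> K"
    and K_commutator: "\<And>a. a \<in> K \<Longrightarrow> s * a - a * s \<in> K"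
    and K_subset_R: "K \<subseteq> R"
    and R_add: "\<And>a b. a \<in> R \<Longrightarrow> b \<in> R \<Longrightarrow> a + b \<in> R"
    and R_K_mult: "\<And>k a. k \<in> K \<Longrightarrow> a \<in> R \<Longrightarrow> k * a \<in> R"
    and R_s_mult: "\<And>a. a \<in> R \<Longrightarrow> s * a \<in> R"
    and R_s_K: "\<And>a. a \<in> R \<Longrightarrow> s * a \<in> K \<Longrightarrow> a = 0"
    and s_nonzero: "s \<noteq> 0"
    and g_in_K: "\<And>i. g i \<in> K"
    and g_indep: "\<And>c f i. (\<And>j. c j \<in> K) \<Longrightarrow> (\<And>j. s * c j = c j * s) \<Longrightarrow> f \<in> K \<Longrightarrow>
      (\<Sum>j\<in>UNIV. c j * g j) = s * f - f * s \<Longrightarrow> c i = 0"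
begin

definition word :: "'i list \<Rightarrow> 'd" where
  "word w = prod_list (map (\<lambda>i. inverse s * g i) w)"

lemma word_simps [simp]: "word [] = 1" "word (i # w) = inverse s * g i * word w"
  by (simp_all add: word_def)

lemma finite_words: "finite {w :: 'i list. length w \<le> n}"
  using finite_lists_length_le[of "UNIV :: 'i set" n] by simp

lemma K_sum: "(\<And>i. i \<in> I \<Longrightarrow> f i \<in> K) \<Longrightarrow> sum f I \<in> K"
  by (induction I rule: infinite_finite_induct) (auto intro: K_zero K_add)

text \<open>Write \<open>s * a = (s * a - a * s) + a * s\<close>; the last \<open>s\<close> cancels
  the leading \<open>inverse s\<close> of a nonempty word and shortens it by one letter. At the
  empty word nothing cancels, so \<open>s * F []\<close> is kept whole.\<close>

definition shift :: "('i list \<Rightarrow> 'd) \<Rightarrow> 'i list \<Rightarrow> 'd" where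
  "shift F w =
     (if w = [] then s * F [] else s * F w - F w * s) + (\<Sum>i\<in>UNIV. F (i # w) * g i)"

lemma sum_shift:
  assumes supp: "\<And>w. n < length w \<Longrightarrow> F w = 0"
  shows "(\<Sum>w | length w \<le> n. shift F w * word w) = s * (\<Sum>w | length w \<le> n. F w * word w)"
proof -
  let ?L = "{w :: 'i list. length w \<le> n}"
  let ?D = "\<lambda>w. if w = [] then s * F [] else s * F w - F w * s"
  let ?E = "\<lambda>w. if w = [] then 0 else F w * s * word w"
  have "(\<Sum>w\<in>?L. (\<Sum>i\<in>UNIV. F (i # w) * g i) * word w)
      = (\<Sum>w\<in>?L. \<Sum>i\<in>UNIV. ?E (i # w))"
    using s_nonzero
    by (intro sum.cong refl) (simp add: sum_distrib_right mult.assoc, simp flip: mult.assoc)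
  also have "\<dots> = (\<Sum>(w, i)\<in>?L \<times> UNIV. ?E (i # w))"
    by (simp add: sum.cartesian_product)
  also have "\<dots> = (\<Sum>v\<in>(\<lambda>(w, i). i # w) ` (?L \<times> UNIV). ?E v)"
    by (subst sum.reindex) (auto simp: inj_on_def o_def case_prod_unfold)
  also have "\<dots> = (\<Sum>v\<in>?L. ?E v)"
  \<comment> \<open>The index sets differ in the empty word, where \<open>?E\<close> is 0 by
    convention, and in the words of length \<open>Suc n\<close>, where \<open>F\<close>
    vanishes.\<close>
  proof (rule sum.mono_neutral_cong)
    show "?E v = 0" if "v \<in> ?L - (\<lambda>(w, i). i # w) ` (?L \<times> UNIV)" for v
      using that by (cases v) force+
    show "?E v = 0" if "v \<in> (\<lambda>(w, i). i # w) ` (?L \<times> UNIV) - ?L" for v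
      using that supp[of v] by auto
  qed (use finite_words in auto)
  finally have "(\<Sum>w\<in>?L. shift F w * word w) = (\<Sum>w\<in>?L. ?D w * word w) + (\<Sum>w\<in>?L. ?E w)"
    by (simp add: shift_def distrib_right sum.distrib)
  also have "\<dots> = (\<Sum>w\<in>?L. s * (F w * word w))"
    unfolding sum.distrib[symmetric] by (intro sum.cong refl) (auto simp: algebra_simps)
  finally show ?thesis by (simp add: sum_distrib_left)
qed

text \<open>Double induction: on the length bound, then on the number of longest words with nonzero
  coefficient. The second number drops under \<open>shift\<close> once a leading coefficient is
  1.\<close>

lemma words_independent:
  assumes "\<And>w. w \<noteq> [] \<Longrightarrow> F w \<in> K" "F [] \<in> R" "\<And>w. n < length w \<Longrightarrow> F w = 0"
    "(\<Sum>w | length w \<le> n. F w * word w) = 0"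
  shows "F w = 0"
  using assms
proof (induction n arbitrary: F w)
  case 0
  have "{w :: 'i list. length w \<le> 0} = {[]}" by auto
  with 0 show ?case by (cases w) auto
next
  case (Suc n)
  note lower = Suc.IH
  from Suc.prems show ?case
  proof (induction "card {w. length w = Suc n \<and> F w \<noteq> 0}" arbitrary: F w rule: less_induct)
    case less
    let ?N = "\<lambda>F. {w. length w = Suc n \<and> F w \<noteq> 0}"
    have fin: "finite (?N F)" for F :: "'i list \<Rightarrow> 'd"
      by (rule finite_subset[OF _ finite_words[of "Suc n"]]) auto
    show "F w = 0"
    proof (cases "?N F = {}")
      case True
      have top: "F w = 0" if "n < length w" for w
        using that True less.prems(3)[of w] by (cases "length w = Suc n") auto
      have "(\<Sum>w | length w \<le> n. F w * word w) = (\<Sum>w | length w \<le> Suc n. F w * word w)"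
        by (rule sum.mono_neutral_left) (use top finite_words in auto)
      with lower[of F w] top less.prems show ?thesis by auto
    next
      case False
      then obtain i0 v where v: "length v = n" "F (i0 # v) \<noteq> 0"
        by (auto simp: length_Suc_conv)
      define F' where "F' w = inverse (F (i0 # v)) * F w" for w
      have inv: "inverse (F (i0 # v)) \<in> K"
        by (simp add: K_inverse less.prems)
      have F'_K: "F' w \<in> K" if "w \<noteq> []" for w
        using that by (auto simp: F'_def intro: K_mult inv less.prems)
      have F'_R: "F' [] \<in> R"
        by (auto simp: F'_def intro: R_K_mult inv less.prems)
      have F'_supp: "F' w = 0" if "Suc n < length w" for w
        using that less.prems by (simp add: F'_def)
      have F'_one: "F' (i0 # v) = 1"
        using v by (simp add: F'_def)
      \<comment> \<open>No longer word feeds into these, so only the commutator remains, and it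
        vanishes where \<open>F'\<close> is 0 or 1.\<close>
      have top: "shift F' w = s * F' w - F' w * s" if "length w = Suc n" for w
        using that F'_supp by (auto simp: shift_def)
      have "card (?N (shift F')) < card (?N F)"
      proof (rule psubset_card_mono[OF fin])
        have "i0 # v \<in> ?N F" "i0 # v \<notin> ?N (shift F')"
          using v F'_one by (auto simp: top)
        moreover have "?N (shift F') \<subseteq> ?N F"
          using top by (auto simp: F'_def)
        ultimately show "?N (shift F') \<subset> ?N F" by blast
      qed
      moreover have "shift F' w \<in> K" if "w \<noteq> []" for w
        using that by (auto simp: shift_def intro!: K_add K_commutator K_sum K_mult F'_K g_in_K)
      moreover have sum_K: "(\<Sum>i\<in>UNIV. F' (i # w) * g i) \<in> K" for w
        by (auto intro!: K_sum K_mult F'_K g_in_K)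
      then have "shift F' [] \<in> R"
        using K_subset_R by (auto simp: shift_def intro!: R_add R_s_mult F'_R)
      moreover have "shift F' w = 0" if "Suc n < length w" for w
        using that F'_supp by (auto simp: shift_def)
      moreover have "(\<Sum>w | length w \<le> Suc n. shift F' w * word w) = 0"
      proof -
        have "(\<Sum>w | length w \<le> Suc n. F' w * word w) = inverse (F (i0 # v)) * 0"
          unfolding less.prems(4)[symmetric] sum_distrib_left by (simp add: F'_def mult.assoc)
        then show ?thesis using sum_shift[of "Suc n" F'] F'_supp by simp
      qed
      ultimately have zero: "shift F' w = 0" for w
        using less.hyps by blast
      have const: "s * F' (i # v) = F' (i # v) * s" for i
        using zero[of "i # v"] top[of "i # v"] v by simp
      have "\<exists>f\<in>K. (\<Sum>i\<in>UNIV. F' (i # v) * g i) = s * f - f * s"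
      proof (cases "v = []")
        \<comment> \<open>Here \<open>F' []\<close> is only known to lie in \<open>R\<close>, but
          the equation at the empty word puts \<open>s * F' []\<close> into \<open>K\<close>, which
          forces \<open>F' [] = 0\<close>.\<close>
        case True
        have "s * F' [] = - (\<Sum>i\<in>UNIV. F' [i] * g i)"
          using zero[of "[]"] by (simp add: shift_def add_eq_0_iff2)
        then have "F' [] = 0"
          using R_s_K F'_R K_uminus sum_K[of "[]"] by metis
        then show ?thesis
          using zero[of "[]"] True K_zero by (intro bexI[of _ 0]) (auto simp: shift_def)
      next
        case False
        then show ?thesis
          using zero[of v] F'_K[of v] K_uminus
          by (intro bexI[of _ "- F' v"]) (auto simp: shift_def add_eq_0_iff2 algebra_simps)
      qed
      then have "F' (i0 # v) = 0"
        using g_indep[of "\<lambda>i. F' (i # v)"] const F'_K by blast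
      with F'_one show ?thesis by simp
    qed
  qed
qed

end

section \<open>Residues of rational functions\<close>

lemma fls_deriv_divide_mult:
  fixes U V :: "'a::field fls"
  assumes "V \<noteq> 0"
  shows "fls_deriv (U / V) * V\<^sup>2 = fls_deriv U * V - U * fls_deriv V"
proof -
  have "fls_deriv U = fls_deriv (U / V * V)"
    using assms by simp
  also have "\<dots> = U / V * fls_deriv V + fls_deriv (U / V) * V"
    by (rule fls_deriv_mult)
  finally show ?thesis
    using assms by (simp add: power2_eq_square distrib_right mult.assoc)
qed

text \<open>The hypothesis says \<open>e / X^(m+1) = (u/v)'\<close>, so the coefficient in question
  is the residue of the derivative of a Laurent series.\<close>

lemma fps_residue_eq_0:
  fixes e u v :: "'a::field_char_0 fps"
  assumes "v \<noteq> 0" "e * v\<^sup>2 = fps_X ^ Suc m * (fps_deriv u * v - u * fps_deriv v)"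
  shows "fps_nth e m = 0"
proof -
  define U V E where "U = fps_to_fls u" and "V = fps_to_fls v" and "E = fps_to_fls e"
  have V: "V \<noteq> 0" using assms(1) by (simp add: V_def)
  define D where "D = fls_deriv (U / V)"
  have "E * V\<^sup>2 = fls_X ^ Suc m * (fls_deriv U * V - U * fls_deriv V)"
    using arg_cong[OF assms(2), of fps_to_fls]
    by (simp add: U_def V_def E_def fls_times_fps_to_fls fls_deriv_fps_to_fls fps_to_fls_power
        del: power_Suc)
  also have "fls_deriv U * V - U * fls_deriv V = D * V\<^sup>2"
    using fls_deriv_divide_mult[OF V] by (simp add: D_def)
  finally have "E = fls_X ^ Suc m * D"
    using V by (simp add: power2_eq_square mult.assoc[symmetric] del: power_Suc)
  then have "fls_nth E (int m) = fls_nth D (-1)"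
    by (simp add: fls_X_power_times_conv_shift del: power_Suc)
  then show ?thesis by (simp add: E_def D_def)
qed

text \<open>The Wronskian is the numerator of \<open>(p/q)'\<close>, and in characteristic 0 a
  Laurent series with zero derivative is constant.\<close>

lemma proportional_if_wronskian_eq_0:
  fixes p q :: "'a::field_char_0 poly"
  assumes "q \<noteq> 0" "pderiv p * q - p * pderiv q = 0"
  obtains c where "p = smult c q"
proof -
  define U V where "U = fps_to_fls (fps_of_poly p)" and "V = fps_to_fls (fps_of_poly q)"
  have V: "V \<noteq> 0"
    using assms(1) fps_of_poly_eq_iff[of q 0] by (simp add: V_def)
  define D where "D = fls_deriv (U / V)"
  have "fls_deriv U * V - U * fls_deriv V = 0"
    using arg_cong[OF assms(2), of "\<lambda>p. fps_to_fls (fps_of_poly p)"]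
    by (simp add: U_def V_def fls_times_fps_to_fls fls_deriv_fps_to_fls fps_of_poly_pderiv
        fps_of_poly_mult fps_of_poly_diff)
  also have "fls_deriv U * V - U * fls_deriv V = D * V\<^sup>2"
    using fls_deriv_divide_mult[OF V] by (simp add: D_def)
  finally have "D = 0" using V by simp
  then obtain c where "U / V = fls_const c"
    unfolding D_def fls_deriv_eq_0_iff by blast
  then have "U = fls_const c * V"
    using V by (simp add: field_simps)
  then have "fps_of_poly p = fps_of_poly (smult c q)"
    by (simp add: U_def V_def fps_of_poly_smult flip: fls_times_fps_to_fls fps_const_to_fls
        fps_to_fls_eq_iff)
  then show ?thesis
    using that fps_of_poly_eq_iff by blast
qed

text \<open>
  The identity below is \<open>a (1 + 1/t)\<^sup>2 + b/(t - 1) = (p/q)'\<close> with denominators cleared. A derivative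
  has no residues, and those of the left-hand side are \<open>2a\<close> at \<open>0\<close> and \<open>b\<close> at \<open>1\<close>.
\<close>

lemma letters_independent_mod_derivatives:
  fixes p q :: "'a::field_char_0 poly"
  assumes "q \<noteq> 0"
    and eq: "(smult a ([:1, 1:]\<^sup>2 * [:-1, 1:]) + smult b ([:0, 1:]\<^sup>2)) * q\<^sup>2 =
      ([:0, 1:]\<^sup>2 * [:-1, 1:]) * (pderiv p * q - p * pderiv q)"
  shows "a = 0" "b = 0"
proof -
  define L where "L = (fps_X - 1 :: 'a fps)"
  have "fps_nth L 0 \<noteq> 0"
    by (simp add: L_def)
  then have L: "fps_of_poly [:-1, 1:] = L" "L \<noteq> 0" "L * inverse L = 1"
    by (auto simp: L_def fps_of_poly_simps inverse_mult_eq_1')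
  \<comment> \<open>The left-hand side times \<open>t^2\<close>, expanded at 0, where
    \<open>t - 1\<close> is invertible. The second summand starts at degree 2, so the coefficient of
    degree 1 is \<open>2a\<close>.\<close>
  define e where "e = fps_const a * (1 + fps_X)\<^sup>2 + fps_const b * fps_X\<^sup>2 * inverse L"
  define u v where "u = fps_of_poly p" and "v = fps_of_poly q"
  have v: "v \<noteq> 0"
    using assms(1) fps_of_poly_eq_iff[of q 0] by (simp add: v_def)
  have "(fps_const a * (1 + fps_X)\<^sup>2 * L + fps_const b * fps_X\<^sup>2) * v\<^sup>2
      = fps_X\<^sup>2 * L * (fps_deriv u * v - u * fps_deriv v)"
    using arg_cong[OF eq, of fps_of_poly] unfolding L(1)[symmetric] u_def v_def
    by (simp only: fps_of_poly_simps) (simp add: algebra_simps)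
  also have "fps_const a * (1 + fps_X)\<^sup>2 * L + fps_const b * fps_X\<^sup>2 = L * e"
    using L(3) by (simp add: e_def algebra_simps)
  finally have "e * v\<^sup>2 = fps_X ^ Suc 1 * (fps_deriv u * v - u * fps_deriv v)"
    using L(2) by (simp add: numeral_2_eq_2 mult.assoc mult.left_commute[of L])
  then have "fps_nth e 1 = 0"
    by (rule fps_residue_eq_0[OF v])
  then show a: "a = 0"
    by (simp add: e_def power2_eq_square fps_mult_nth algebra_simps mult.assoc)
  \<comment> \<open>Substituting \<open>t + 1\<close> for \<open>t\<close> moves the pole at 1 to 0.
    With \<open>a = 0\<close> the factor \<open>t^2\<close> cancels and a simple pole with residue
    \<open>b\<close> remains.\<close>
  define u' v' where "u' = fps_of_poly (pcompose p [:1, 1:])"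
    and "v' = fps_of_poly (pcompose q [:1, 1:])"
  have "[:0, 1:]\<^sup>2 * (smult b (q\<^sup>2)) = [:0, 1:]\<^sup>2 * ([:-1, 1:] * (pderiv p * q - p * pderiv q))"
    using eq a
    by (simp only: smult_0_left add_0 mult_smult_left mult_smult_right mult.assoc)
  then have "smult b (q\<^sup>2) = [:-1, 1:] * (pderiv p * q - p * pderiv q)"
    by (subst (asm) mult_cancel_left) simp
  then have "pcompose (smult b (q * q)) [:1, 1:]
      = pcompose ([:-1, 1:] * (pderiv p * q - p * pderiv q)) [:1, 1:]"
    by (simp only: power2_eq_square)
  also have "\<dots> = pcompose [:-1, 1:] [:1, 1:] *
      (pderiv (pcompose p [:1, 1:]) * pcompose q [:1, 1:]
        - pcompose p [:1, 1:] * pderiv (pcompose q [:1, 1:]))"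
    by (simp only: pcompose_mult pcompose_diff pderiv_pcompose) (simp add: pderiv_pCons)
  also have "pcompose [:-1, 1:] [:1, 1:] = ([:0, 1:] :: 'a poly)"
    by (simp add: pcompose_pCons)
  finally have "fps_const b * v'\<^sup>2 = fps_X ^ Suc 0 * (fps_deriv u' * v' - u' * fps_deriv v')"
    by (simp only: u'_def v'_def pcompose_mult pcompose_smult power2_eq_square
        flip: fps_of_poly_simps fps_of_poly_eq_iff) simp
  moreover have "v' \<noteq> 0"
    using assms(1) fps_of_poly_eq_iff[of "pcompose q [:1, 1:]" 0]
    by (simp add: v'_def pcompose_eq_0_iff)
  ultimately have "fps_nth (fps_const b) 0 = 0"
    by (intro fps_residue_eq_0)
  then show "b = 0" by simp
qed

section \<open>Weyl pairs in a division ring\<close>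

lemma scaleQ_zero_left [simp]: "0 *\<^sub>Q (a :: 'a::rat_algebra_1) = 0"
  by (rule module.scale_zero_left[OF module_scaleQ])

lemma scaleQ_zero_right [simp]: "c *\<^sub>Q (0 :: 'a::rat_algebra_1) = 0"
  by (rule module.scale_zero_right[OF module_scaleQ])

lemma scaleQ_eq_0_iff [simp]: "c *\<^sub>Q (a :: 'a::rat_algebra_1) = 0 \<longleftrightarrow> c = 0 \<or> a = 0"
proof -
  have "inverse c *\<^sub>Q (c *\<^sub>Q a) = a" if "c \<noteq> 0"
    using that by (simp add: scaleQ_scaleQ scaleQ_one)
  then show ?thesis by (metis scaleQ_zero_left scaleQ_zero_right)
qed

lemma of_nat_eq_scaleQ: "of_nat n = of_nat n *\<^sub>Q (1 :: 'a::rat_algebra_1)"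
  by (induction n) (simp_all add: scaleQ_add_left scaleQ_one)

lemma commute_inverse:
  fixes a b :: "'a::division_ring"
  assumes "a * b = b * a"
  shows "a * inverse b = inverse b * a"
  using assms mult_commute_imp_mult_inverse_commute by metis

locale weyl_pair =
  fixes s t :: "'d::{division_ring, rat_algebra_1}"
  assumes s_t: "s * t - t * s = 1"
begin

section \<open>The field of rational functions in \<open>t\<close> inside the division ring\<close>

definition ev :: "rat poly \<Rightarrow> 'd" where
  "ev p = fold_coeffs (\<lambda>c a. c *\<^sub>Q 1 + t * a) p 0"

lemma ev_0 [simp]: "ev 0 = 0"
  by (simp add: ev_def)

lemma ev_pCons [simp]: "ev (pCons c p) = c *\<^sub>Q 1 + t * ev p"
  by (cases "p = 0 \<and> c = 0") (auto simp: ev_def)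

lemma ev_1 [simp]: "ev 1 = 1"
  by (simp add: one_pCons scaleQ_one)

lemma ev_add: "ev (p + q) = ev p + ev q"
  by (induction p q rule: poly_induct2) (simp_all add: scaleQ_add_left algebra_simps)

lemma ev_smult: "ev (smult c p) = c *\<^sub>Q ev p"
  by (induction p) (simp_all add: scaleQ_add_right scaleQ_scaleQ mult_scaleQ_right)

lemma ev_mult: "ev (p * q) = ev p * ev q"
  by (induction p)
    (simp_all add: ev_add ev_smult distrib_right mult_scaleQ_left mult.assoc)

lemma ev_diff: "ev (p - q) = ev p - ev q"
  using ev_add[of "p - q" q] by simp

lemma ev_commute: "ev p * ev q = ev q * ev p"
  by (metis ev_mult mult.commute)

lemma s_ev: "s * ev p = ev p * s + ev (pderiv p)"
proof (induction p)
  case (pCons c p)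
  have "s * (t * ev p) = t * (s * ev p) + ev p"
    using arg_cong[OF s_t, of "\<lambda>a. a * ev p"] by (simp add: algebra_simps)
  with pCons show ?case
    by (simp add: pderiv_pCons ev_add algebra_simps mult_scaleQ_left mult_scaleQ_right)
qed simp

text \<open>Transcendence of \<open>t\<close>: commuting a relation with \<open>s\<close>
  differentiates it, which lowers the degree until a nonzero constant would have to vanish.\<close>

lemma ev_eq_0_iff [simp]: "ev p = 0 \<longleftrightarrow> p = 0"
proof
  show "p = 0" if "ev p = 0"
    using that
  proof (induction "degree p" arbitrary: p rule: less_induct)
    case less
    show ?case
    proof (cases "degree p = 0")
      case True
      with less.prems show ?thesis
        by (auto elim!: degree_eq_zeroE)
    next
      case False
      have "ev (pderiv p) = 0"
        using s_ev[of p] less.prems by simp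
      with less.hyps[of "pderiv p"] False show ?thesis
        by (simp add: degree_pderiv pderiv_eq_0_iff)
    qed
  qed
qed simp

lemma ev_eq_iff [simp]: "ev p = ev q \<longleftrightarrow> p = q"
  using ev_eq_0_iff[of "p - q"] by (simp add: ev_diff del: ev_eq_0_iff)

definition ratio :: "rat poly \<Rightarrow> rat poly \<Rightarrow> 'd" where
  "ratio p q = ev p * inverse (ev q)"

lemma ratio_mult_ev: "q \<noteq> 0 \<Longrightarrow> ratio p q * ev q = ev p"
  by (simp add: ratio_def mult.assoc)

lemma ratio_eqI: "q \<noteq> 0 \<Longrightarrow> a * ev q = ev p \<Longrightarrow> a = ratio p q"
  by (simp add: ratio_def eq_divide_eq flip: divide_inverse)

lemma ratio_eq_iff:
  assumes "q \<noteq> 0" "v \<noteq> 0"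
  shows "ratio p q = ratio u v \<longleftrightarrow> p * v = u * q"
proof -
  have "ratio p q = ratio u v \<longleftrightarrow> ratio p q * ev q * ev v = ratio u v * ev v * ev q"
    using assms by (simp add: mult.assoc ev_commute[of q v])
  also have "\<dots> \<longleftrightarrow> p * v = u * q"
    using assms by (simp add: ratio_mult_ev flip: ev_mult)
  finally show ?thesis .
qed

lemma ratio_add:
  assumes "q \<noteq> 0" "v \<noteq> 0"
  shows "ratio p q + ratio u v = ratio (p * v + u * q) (q * v)"
proof (rule ratio_eqI)
  have "ratio u v * (ev q * ev v) = ratio u v * ev v * ev q"
    by (simp add: mult.assoc ev_commute[of q v])
  then show "(ratio p q + ratio u v) * ev (q * v) = ev (p * v + u * q)"
    using assms by (simp add: distrib_right ev_mult ev_add ratio_mult_ev flip: mult.assoc)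
qed (use assms in auto)

lemma ev_commute_ratio: "ev p * ratio u v = ratio u v * ev p"
proof -
  have "ev p * ratio u v = ev u * (ev p * inverse (ev v))"
    by (simp add: ratio_def ev_commute[of p u] flip: mult.assoc)
  then show ?thesis
    by (simp add: ratio_def commute_inverse[OF ev_commute, of p v] mult.assoc)
qed

lemma ratio_mult:
  assumes "q \<noteq> 0" "v \<noteq> 0"
  shows "ratio p q * ratio u v = ratio (p * u) (q * v)"
proof (rule ratio_eqI)
  have "ratio p q * ratio u v * (ev q * ev v) = ratio p q * (ev q * ratio u v) * ev v"
    by (simp add: mult.assoc ev_commute_ratio)
  also have "\<dots> = (ratio p q * ev q) * (ratio u v * ev v)"
    by (simp add: mult.assoc)
  finally show "ratio p q * ratio u v * ev (q * v) = ev (p * u)"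
    using assms by (simp add: ev_mult ratio_mult_ev)
qed (use assms in auto)

lemma ratio_inverse:
  assumes "p \<noteq> 0" "q \<noteq> 0"
  shows "inverse (ratio p q) = ratio q p"
proof (rule inverse_unique)
  have "ratio p q * ratio q p = ratio (p * q) (p * q)"
    using assms by (simp add: ratio_mult mult.commute)
  then show "ratio p q * ratio q p = 1"
    using assms by (simp add: ratio_def)
qed

lemma ratio_smult: "c *\<^sub>Q ratio p q = ratio (smult c p) q"
  by (simp add: ratio_def ev_smult mult_scaleQ_left)

lemma ratio_zero [simp]: "ratio 0 q = 0"
  by (simp add: ratio_def)

text \<open>The quotient rule for the derivation given by commutation with \<open>s\<close>.\<close>

lemma ratio_commutator:
  assumes "q \<noteq> 0"
  shows "s * ratio p q - ratio p q * s = ratio (pderiv p * q - p * pderiv q) (q\<^sup>2)"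
proof (rule ratio_eqI)
  let ?f = "ratio p q"
  have "s * ?f * ev q = ev p * s + ev (pderiv p)"
    by (simp add: mult.assoc ratio_mult_ev[OF assms] s_ev)
  moreover have "?f * s * ev q = ?f * ev q * s + ?f * ev (pderiv q)"
    by (simp add: mult.assoc s_ev distrib_left)
  ultimately have 1: "(s * ?f - ?f * s) * ev q = ev (pderiv p) - ?f * ev (pderiv q)"
    by (simp add: left_diff_distrib ratio_mult_ev[OF assms])
  have "(s * ?f - ?f * s) * ev (q\<^sup>2) = ((s * ?f - ?f * s) * ev q) * ev q"
    by (simp add: power2_eq_square ev_mult mult.assoc)
  also have "\<dots> = ev (pderiv p) * ev q - ?f * ev q * ev (pderiv q)"
    unfolding 1 by (simp add: left_diff_distrib mult.assoc ev_commute[of q])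
  also have "\<dots> = ev (pderiv p * q - p * pderiv q)"
    by (simp add: ratio_mult_ev[OF assms] ev_mult ev_diff)
  finally show "(s * ?f - ?f * s) * ev (q\<^sup>2) = ev (pderiv p * q - p * pderiv q)" .
qed (use assms in auto)

definition K :: "'d set" where
  "K = {ratio p q | p q. q \<noteq> 0}"

lemma ratio_in_K: "q \<noteq> 0 \<Longrightarrow> ratio p q \<in> K"
  by (auto simp: K_def)

lemma K_E:
  assumes "a \<in> K"
  obtains p q where "q \<noteq> 0" "a = ratio p q"
  using assms by (auto simp: K_def)

lemma t_commute_K: "a \<in> K \<Longrightarrow> t * a = a * t"
  using ev_commute_ratio[of "[:0, 1:]"] by (auto elim!: K_E simp: scaleQ_one)

lemma constants_of_K:
  assumes "a \<in> K" "s * a = a * s"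
  obtains c where "a = c *\<^sub>Q 1"
proof -
  obtain p q where q: "q \<noteq> 0" "a = ratio p q"
    using assms(1) by (rule K_E)
  have "ratio (pderiv p * q - p * pderiv q) (q\<^sup>2) = ratio 0 1"
    using ratio_commutator[OF q(1), of p] q assms(2) by simp
  then have "pderiv p * q - p * pderiv q = 0"
    using q(1) by (subst (asm) ratio_eq_iff) auto
  then obtain c where "p = smult c q"
    using proportional_if_wronskian_eq_0 q(1) by blast
  then have "a = c *\<^sub>Q 1"
    using q by (simp add: ratio_def ev_smult mult_scaleQ_left)
  with that show ?thesis .
qed

text \<open>
  Elements on which \<open>ad t\<close> is nilpotent play the part of differential operators over \<open>K\<close>. Since
  \<open>ad t\<close> maps \<open>s\<^sup>-\<^sup>m\<close> to \<open>m s\<^sup>-\<^sup>m\<^sup>-\<^sup>1\<close>, the element \<open>s\<^sup>-\<^sup>1\<close> is not among them.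
\<close>

definition ad :: "'d \<Rightarrow> 'd" where
  "ad a = t * a - a * t"

definition R :: "'d set" where
  "R = {a. \<exists>n. (ad ^^ n) a = 0}"

lemma ad_pow_0 [simp]: "(ad ^^ n) 0 = 0"
  by (induction n) (simp_all add: ad_def)

lemma ad_pow_add: "(ad ^^ n) (a + b) = (ad ^^ n) a + (ad ^^ n) b"
  by (induction n) (simp_all add: ad_def algebra_simps)

lemma ad_pow_mult_left: "t * k = k * t \<Longrightarrow> (ad ^^ n) (k * a) = k * (ad ^^ n) a"
  by (induction n) (simp_all add: ad_def algebra_simps, simp flip: mult.assoc)

lemma ad_pow_mult_right: "t * k = k * t \<Longrightarrow> (ad ^^ n) (a * k) = (ad ^^ n) a * k"
  by (induction n) (simp_all add: ad_def algebra_simps)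

lemma ad_in_R_iff: "ad a \<in> R \<longleftrightarrow> a \<in> R"
proof
  assume "ad a \<in> R"
  then obtain n where "(ad ^^ n) (ad a) = 0" by (auto simp: R_def)
  then have "(ad ^^ Suc n) a = 0" by (simp add: funpow_swap1)
  then show "a \<in> R" unfolding R_def by blast
next
  assume "a \<in> R"
  then obtain n where "(ad ^^ n) a = 0" by (auto simp: R_def)
  then have "(ad ^^ n) (ad a) = 0"
    using funpow_swap1[of ad n a] ad_pow_0[of 1] by simp
  then show "ad a \<in> R" by (auto simp: R_def)
qed

lemma add_in_R:
  assumes "a \<in> R" "b \<in> R"
  shows "a + b \<in> R"
proof -
  obtain m n where "(ad ^^ m) a = 0" "(ad ^^ n) b = 0"
    using assms by (auto simp: R_def)
  then have "(ad ^^ (n + m)) a = 0" "(ad ^^ (m + n)) b = 0"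
    by (simp_all add: funpow_add)
  then have "(ad ^^ (m + n)) (a + b) = 0"
    by (simp add: ad_pow_add add.commute)
  then show ?thesis by (auto simp: R_def)
qed

lemma mult_in_R:
  assumes "t * k = k * t" "a \<in> R"
  shows "k * a \<in> R" "a * k \<in> R"
  using assms by (auto simp: R_def ad_pow_mult_left ad_pow_mult_right intro!: exI)

text \<open>Induction on the order of nilpotency through \<open>ad (s * a) = s * ad a - a\<close>,
  where \<open>ad a\<close> has smaller order.\<close>

lemma s_mult_in_R: "a \<in> R \<Longrightarrow> s * a \<in> R"
proof -
  have "s * a \<in> R" if "(ad ^^ n) a = 0" for n a
    using that
  proof (induction n arbitrary: a)
    case 0
    then show ?case by (auto simp: R_def intro: exI[of _ 0])
  next
    case (Suc n)
    have "t * s = s * t - 1"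
      using s_t by (simp add: algebra_simps)
    then have "ad (s * a) = s * ad a + (-1) * a"
      by (simp add: ad_def left_diff_distrib right_diff_distrib flip: mult.assoc)
    moreover have "s * ad a \<in> R"
      using Suc by (simp add: funpow_swap1)
    moreover have "a \<in> R"
      using Suc.prems by (auto simp: R_def simp del: funpow.simps)
    moreover have "(-1) * a \<in> R" if "a \<in> R"
      using that by (intro mult_in_R(1)) simp_all
    ultimately have "ad (s * a) \<in> R"
      by (simp only: add_in_R)
    then show ?case by (simp add: ad_in_R_iff)
  qed
  then show "a \<in> R \<Longrightarrow> s * a \<in> R" by (auto simp: R_def)
qed

lemma K_subset_R: "K \<subseteq> R"
  using t_commute_K by (auto simp: R_def ad_def intro!: exI[of _ 1])

lemma s_nonzero: "s \<noteq> 0"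
  using s_t by auto

lemma ad_inverse_s_pow: "ad (inverse s ^ m) = of_nat m * inverse s ^ Suc m"
proof (induction m)
  case (Suc m)
  let ?u = "inverse s"
  have "t * ?u - ?u * t = ?u * (s * t - t * s) * ?u"
    using s_nonzero by (simp add: algebra_simps flip: mult.assoc) (simp add: mult.assoc)
  then have u: "t * ?u - ?u * t = ?u * ?u" by (simp add: s_t)
  have "ad (?u ^ Suc m) = (t * ?u - ?u * t) * ?u ^ m + ?u * ad (?u ^ m)"
    by (simp add: ad_def algebra_simps)
  also have "\<dots> = ?u * ?u * ?u ^ m + ?u * (of_nat m * ?u ^ Suc m)"
    by (simp add: u Suc.IH)
  also have "?u * (of_nat m * ?u ^ Suc m) = of_nat m * (?u * ?u ^ Suc m)"
    by (metis mult.assoc mult_of_nat_commute)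
  finally show ?case by (simp add: distrib_right mult.assoc)
qed (simp add: ad_def)

lemma inverse_s_notin_R: "inverse s \<notin> R"
proof -
  have "(ad ^^ n) (inverse s) = of_nat (fact n) * inverse s ^ Suc n" for n
  proof (induction n)
    case (Suc n)
    have "(ad ^^ Suc n) (inverse s) = ad (of_nat (fact n) * inverse s ^ Suc n)"
      using Suc by simp
    also have "\<dots> = of_nat (fact n) * ad (inverse s ^ Suc n)"
      using ad_pow_mult_left[of "of_nat (fact n)" 1 "inverse s ^ Suc n"]
      by (simp add: mult_of_nat_commute)
    also have "\<dots> = of_nat (fact n * Suc n) * inverse s ^ Suc (Suc n)"
      by (simp only: ad_inverse_s_pow of_nat_mult mult.assoc)
    also have "fact n * Suc n = (fact (Suc n) :: nat)" by simp
    finally show ?case .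
  qed simp
  moreover have "(of_nat (fact n) :: 'd) \<noteq> 0" for n
    using of_nat_eq_scaleQ[of "fact n", where 'a = 'd] by simp
  ultimately show ?thesis
    using s_nonzero by (auto simp: R_def)
qed

text \<open>\<open>R\<close> is stable under multiplication by elements commuting with
  \<open>t\<close>. If \<open>k = s * a\<close> were a nonzero element of \<open>K\<close>, then
  \<open>a * inverse k = inverse s\<close> would lie in \<open>R\<close>.\<close>

lemma R_s_K:
  assumes "a \<in> R" "s * a \<in> K"
  shows "a = 0"
proof (rule ccontr)
  assume "a \<noteq> 0"
  define k where "k = s * a"
  have k: "k \<noteq> 0" "a = inverse s * k"
    using \<open>a \<noteq> 0\<close> s_nonzero by (auto simp: k_def simp flip: mult.assoc)
  have "t * inverse k = inverse k * t"
    using t_commute_K[OF assms(2)] by (simp add: k_def commute_inverse)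
  then have "a * inverse k \<in> R"
    using mult_in_R(2) assms(1) by blast
  also have "a * inverse k = inverse s"
    using k by (simp add: mult.assoc)
  finally show False using inverse_s_notin_R by blast
qed

text \<open>
  The element \<open>G = 1 + 1/t\<close> is chosen such that \<open>G\<^sup>2\<close> has a nonzero residue at \<open>0\<close>; the other
  letter \<open>1/(t - 1)\<close> has its only residue at \<open>1\<close>.
\<close>

definition G :: 'd where
  "G = ratio [:1, 1:] [:0, 1:]"

definition letter :: "bool \<Rightarrow> 'd" where
  "letter i = (if i then G * G else ratio 1 [:-1, 1:])"

lemma letter_eq:
  "letter True = ratio ([:1, 1:]\<^sup>2) ([:0, 1:]\<^sup>2)" "letter False = ratio 1 [:-1, 1:]"
  by (simp_all add: letter_def G_def ratio_mult power2_eq_square)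

text \<open>The constants of \<open>K\<close> are rational scalars, so clearing denominators turns
  the equation into the polynomial identity settled by residues.\<close>

lemma letter_independent:
  assumes "\<And>j. c j \<in> K" "\<And>j. s * c j = c j * s" "f \<in> K"
    and eq: "(\<Sum>j\<in>UNIV. c j * letter j) = s * f - f * s"
  shows "c i = 0"
proof -
  obtain a b where c: "c True = a *\<^sub>Q 1" "c False = b *\<^sub>Q 1"
    using constants_of_K assms(1,2) by metis
  obtain p q where f: "q \<noteq> 0" "f = ratio p q"
    using assms(3) by (rule K_E)
  let ?X = "[:0, 1:]\<^sup>2 :: rat poly" and ?Y = "[:-1, 1:] :: rat poly"
  have nz: "?X \<noteq> 0" "?Y \<noteq> 0" "q\<^sup>2 \<noteq> 0"
    using f(1) by simp_all
  then have nz_mult: "?X * ?Y \<noteq> 0"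
    by (simp only: mult_eq_0_iff) simp
  have "a *\<^sub>Q letter True + b *\<^sub>Q letter False = s * f - f * s"
    using eq by (simp add: UNIV_bool c mult_scaleQ_left add.commute)
  then have "ratio (smult a ([:1, 1:]\<^sup>2) * ?Y + smult b 1 * ?X) (?X * ?Y)
      = ratio (pderiv p * q - p * pderiv q) (q\<^sup>2)"
    unfolding letter_eq ratio_smult f(2) ratio_commutator[OF f(1)] ratio_add[OF nz(1,2)] .
  then have "(smult a ([:1, 1:]\<^sup>2) * ?Y + smult b 1 * ?X) * q\<^sup>2
      = (pderiv p * q - p * pderiv q) * (?X * ?Y)"
    unfolding ratio_eq_iff[OF nz_mult nz(3)] .
  then have "(smult a ([:1, 1:]\<^sup>2 * ?Y) + smult b ?X) * q\<^sup>2
      = ?X * ?Y * (pderiv p * q - p * pderiv q)"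
    by (simp only: mult_smult_left mult_smult_right mult_1 mult.commute)
  from letters_independent_mod_derivatives[OF f(1) this] show ?thesis
    by (cases i) (simp_all add: c)
qed

sublocale words: ore_words s K R letter
proof
  show "a + b \<in> K" "a * b \<in> K" if "a \<in> K" "b \<in> K" for a b
    using that by (auto elim!: K_E simp: ratio_add ratio_mult intro!: ratio_in_K)
  show "inverse a \<in> K" if "a \<in> K" for a
  proof -
    from that obtain p q where "q \<noteq> 0" "a = ratio p q" by (rule K_E)
    then show ?thesis
      \<comment> \<open>Since \<open>inverse 0 = 0\<close>, a zero numerator requires
        \<open>0 \<in> K\<close>, supplied by \<open>ratio 0 1\<close>.\<close>
      by (cases "p = 0") (auto simp: ratio_inverse intro: ratio_in_K ratio_in_K[of 1 0, simplified])
  qed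
  show "0 \<in> K"
    using ratio_in_K[of 1 0] by simp
  show "- a \<in> K" if "a \<in> K" for a
  proof -
    from that obtain p q where q: "q \<noteq> 0" "a = ratio p q" by (rule K_E)
    have "- a = ratio (- p) q"
      using ev_diff[of 0 p] q by (simp add: ratio_def)
    with q show ?thesis by (simp add: ratio_in_K)
  qed
  show "s * a - a * s \<in> K" if "a \<in> K" for a
    using that by (auto elim!: K_E simp: ratio_commutator intro!: ratio_in_K)
  show "letter i \<in> K" for i
    by (cases i) (auto simp: letter_eq intro!: ratio_in_K)
  show "c i = 0" if "\<And>j. c j \<in> K" "\<And>j. s * c j = c j * s" "f \<in> K"
    "(\<Sum>j\<in>UNIV. c j * letter j) = s * f - f * s" for c f i
    using letter_independent that by blast
qed (use K_subset_R add_in_R mult_in_R(1) t_commute_K s_mult_in_R R_s_K s_nonzero in auto)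

section \<open>The two symmetric elements and their freeness\<close>

definition gen :: "bool \<Rightarrow> 'd" where
  "gen i = G * inverse s * letter i * inverse s * G"

definition code :: "bool free_monoid \<Rightarrow> bool list" where
  "code w = concat (map (\<lambda>i. [i, True]) (letters w))"

lemma inj_code: "inj code"
proof (rule injI)
  have "u = v" if "concat (map (\<lambda>i. [i, True]) u) = concat (map (\<lambda>i. [i, True]) v)"
    for u v :: "bool list"
    using that by (induction u v rule: list_induct2') auto
  then show "code v = code w \<Longrightarrow> v = w" for v w
    unfolding code_def by (simp add: free_monoid.expand)
qed

text \<open>The \<open>G\<close> ending one factor meets the \<open>G\<close> starting the next, and
  \<open>G * G\<close> is \<open>letter True\<close>; this accounts for the \<open>True\<close>
  after each letter in \<open>code\<close>. The extra \<open>G\<close> on the right completes the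
  last pair.\<close>

lemma prod_gen_mult_G: "prod_list (map gen (letters w)) * G = G * words.word (code w)"
proof -
  have "prod_list (map gen v) * G = G * words.word (concat (map (\<lambda>i. [i, True]) v))" for v
    by (induction v) (simp_all add: gen_def letter_def[of True] mult.assoc)
  then show ?thesis by (simp add: code_def)
qed

lemma G_nonzero: "G \<noteq> 0"
  by (simp add: G_def ratio_def del: ev_pCons)

text \<open>Multiplied by \<open>G\<close> on the right, a relation becomes a combination of
  distinct words with coefficients in \<open>K\<close>, to which \<open>words_independent\<close>
  applies.\<close>

lemma inj_free_eval_gen: "inj (free_eval gen)"
proof -
  have zero: "p = 0" if "free_eval gen p = 0" for p
  proof -
    let ?S = "Poly_Mapping.keys p"
    \<comment> \<open>The coefficients of \<open>p\<close> carried along the injection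
      \<open>code\<close>, with the left factor \<open>G\<close> from \<open>prod_gen_mult_G\<close>
      absorbed.\<close>
    define F where "F v = (if v \<in> range code
      then Poly_Mapping.lookup p (inv code v) *\<^sub>Q G else 0)" for v
    have F_code: "F (code w) = Poly_Mapping.lookup p w *\<^sub>Q G" for w
      by (simp add: F_def inj_code)
    have F_zero: "F v = 0" if "v \<notin> code ` ?S" for v
    proof (cases "v \<in> range code")
      case True
      with that obtain w where "v = code w" "w \<notin> ?S" by auto
      then show ?thesis by (simp add: F_code in_keys_iff)
    qed (simp add: F_def)
    obtain N where N: "\<And>v. v \<in> code ` ?S \<Longrightarrow> length v \<le> N"
      using finite_nat_set_iff_bounded_le[of "length ` code ` ?S"] by auto
    have "(\<Sum>v | length v \<le> N. F v * words.word v) = (\<Sum>v\<in>code ` ?S. F v * words.word v)"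
      using N F_zero by (intro sum.mono_neutral_right words.finite_words) auto
    also have "\<dots> = (\<Sum>w\<in>?S. F (code w) * words.word (code w))"
      by (subst sum.reindex) (auto intro: inj_on_subset[OF inj_code])
    also have "\<dots> = free_eval gen p * G"
      unfolding free_eval_def sum_distrib_right
      by (simp add: F_code mult_scaleQ_left prod_gen_mult_G)
    finally have sum: "(\<Sum>v | length v \<le> N. F v * words.word v) = 0"
      using that by simp
    have "c *\<^sub>Q G \<in> K" for c
      by (simp add: G_def ratio_smult ratio_in_K)
    then have F_K: "F v \<in> K" for v
      by (simp add: F_def words.K_zero)
    have F_long: "F v = 0" if "N < length v" for v
      using that N[of v] F_zero[of v] by (cases "v \<in> code ` ?S") simp_all
    have "F v = 0" for v
      using words.words_independent[OF F_K _ F_long sum] F_K K_subset_R by blast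
    then have "Poly_Mapping.lookup p w = 0" for w
      using F_code[of w] G_nonzero by simp
    then show "p = 0"
      by (intro poly_mapping_eqI) simp
  qed
  show ?thesis
  proof (rule injI)
    fix p q assume "free_eval gen p = free_eval gen q"
    then have "free_eval gen (p - q) = 0"
      using free_eval_add[of gen "p - q" q] by simp
    then show "p = q" using zero[of "p - q"] by simp
  qed
qed

text \<open>\<open>gen i\<close> is a palindrome. Its factors from \<open>K\<close> are fixed, and
  \<open>inverse s\<close> changes sign but occurs twice.\<close>

lemma gen_fixed:
  assumes inv: "rat_involution \<sigma>" and s: "\<sigma> s = - s" and t: "\<sigma> t = t"
  shows "\<sigma> (gen i) = gen i"
proof -
  have add: "\<sigma> (a + b) = \<sigma> a + \<sigma> b" and scale: "\<sigma> (q *\<^sub>Q a) = q *\<^sub>Q \<sigma> a"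
    and mult: "\<sigma> (a * b) = \<sigma> b * \<sigma> a" and \<sigma>\<sigma>: "\<sigma> (\<sigma> a) = a" for a b q
    using inv by (auto simp: rat_involution_def)
  have one: "\<sigma> 1 = 1"
    using mult[of 1 "\<sigma> 1"] \<sigma>\<sigma>[of 1] by simp
  have zero: "\<sigma> 0 = 0"
    using add[of 0 0] by simp
  have inverse: "\<sigma> (inverse a) = inverse (\<sigma> a)" for a
  proof (cases "a = 0")
    case False
    then have "\<sigma> (inverse a) * \<sigma> a = 1"
      using mult[of a "inverse a"] one by simp
    then have "inverse (\<sigma> (inverse a)) = \<sigma> a"
      by (rule inverse_unique)
    then show ?thesis by (metis inverse_inverse_eq)
  qed (simp add: zero)
  have ev_fixed: "\<sigma> (ev p) = ev p" for p
  proof (induction p)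
    case (pCons c p)
    have "t * ev p = ev p * t"
      using ev_commute[of "[:0, 1:]" p] by (simp add: scaleQ_one)
    with pCons show ?case
      by (simp add: add scale mult one t)
  qed (simp add: zero)
  \<comment> \<open>The reversal of products is harmless because numerator and inverse denominator
    commute.\<close>
  have ratio_fixed: "\<sigma> (ratio p q) = ratio p q" for p q
    using commute_inverse[OF ev_commute, of p q] by (simp add: ratio_def mult inverse ev_fixed)
  then have "\<sigma> G = G" "\<sigma> (letter i) = letter i"
    by (simp_all add: G_def letter_def mult)
  then show ?thesis
    by (simp add: gen_def mult inverse s mult.assoc)
qed

end

theorem theorem1p3:
  fixes \<iota> :: "weyl \<Rightarrow> 'd::{division_ring, rat_algebra_1}"
    and star :: "weyl \<Rightarrow> weyl"
    and star\<^sub>D :: "'d \<Rightarrow> 'd"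
  assumes fractions: "division_ring_of_fractions \<iota>"
    and star: "rat_involution star" "star weyl_s = - weyl_s" "star weyl_t = weyl_t"
    and star_D: "rat_involution star\<^sub>D" "\<And>a. star\<^sub>D (\<iota> a) = \<iota> (star a)"
  shows "\<exists>(B :: 'd set) x y. star\<^sub>D x = x \<and> star\<^sub>D y = y \<and>
           freely_generated_by B (\<lambda>i::bool. if i then x else y)"
proof -
  have hom: "\<iota> (a + b) = \<iota> a + \<iota> b" "\<iota> (a * b) = \<iota> a * \<iota> b" "\<iota> 1 = 1" for a b
    using fractions by (auto simp: division_ring_of_fractions_def rat_algebra_hom_def)
  have diff: "\<iota> (a - b) = \<iota> a - \<iota> b" for a b
    using hom(1)[of "a - b" b] by simp
  interpret weyl_pair "\<iota> weyl_s" "\<iota> weyl_t"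
  proof
    show "\<iota> weyl_s * \<iota> weyl_t - \<iota> weyl_t * \<iota> weyl_s = 1"
      by (simp add: weyl_relation hom flip: hom(2) diff)
  qed
  have "\<iota> (- weyl_s) = - \<iota> weyl_s"
    using diff[of 0 weyl_s] hom(1)[of 0 0] by simp
  then have "star\<^sub>D (gen i) = gen i" for i
    using star star_D by (intro gen_fixed) simp_all
  moreover have "(\<lambda>i. if i then gen True else gen False) = gen"
    by auto
  then have "freely_generated_by (generated_rat_subalgebra (range gen))
      (\<lambda>i. if i then gen True else gen False)"
    by (simp only: freely_generated_by_def inj_free_eval_gen simp_thms)
  ultimately show ?thesis by blast
qed

end
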